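(* For $0<b<1$ let $$\mathcal F_{\le b}=\{(x,y,z)\in\mathbb R^3 : z=xy,\ 0\le x\le 1,\ 0\le y\le 1,\ 0\le z\le b\},$$ $$\mathcal F_{\ge b}=\{(x,y,z)\in\mathbb R^3 : z=xy,\ 0\le x\le 1,\ 0\le y\le 1,\ b\le z\le 1\}.$$ The sum of the volumes of the two convex hulls, $\operatorname{vol}(\operatorname{conv}(\mathcal F_{\le b}))+\operatorname{vol}(\operatorname{conv}(\mathcal F_{\ge b}))$, is minimized at approximately $b=0.2$; the exact minimizer satisfies the nonlinear equation $\ln(b)=2(b-1)$.
   Context: $\operatorname{conv}$ denotes the convex hull in $\mathbb R^3$ and $\operatorname{vol}$ denotes three-dimensional volume (Lebesgue measure). *)

theory Defs
  imports "HOL-Analysis.Analysis"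
begin

definition F_le :: "real \<Rightarrow> (real \<times> real \<times> real) set" where
  "F_le b = {(x, y, z). z = x * y \<and> 0 \<le> x \<and> x \<le> 1 \<and> 0 \<le> y \<and> y \<le> 1 \<and> 0 \<le> z \<and> z \<le> b}"

definition F_ge :: "real \<Rightarrow> (real \<times> real \<times> real) set" where
  "F_ge b = {(x, y, z). z = x * y \<and> 0 \<le> x \<and> x \<le> 1 \<and> 0 \<le> y \<and> y \<le> 1 \<and> b \<le> z \<and> z \<le> 1}"

definition hull_volume_sum :: "real \<Rightarrow> real" where
  "hull_volume_sum b =
     measure lebesgue (convex hull (F_le b)) + measure lebesgue (convex hull (F_ge b))"

end

(*
  At height z the cross-sections of both hulls are truncated hyperbolic regions
    (x - s)(y - s) >= r^2 b,  x, y >= s + r b,  x + y <= h + 2 s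
  with s, r, h affine in z: the upper hull is the cone with apex (1,1,1) over the convex hull K of
  the arc xy = b (s, r interpolate between K and the apex), and for the lower hull the slice at
  z = t b is (1 - t) T + t K with T the triangle (0,0), (1,0), (0,1).
  Integrating the slice areas, the volume sum is (1 + 2 b - 2 b^2 + 2 b ln b) / 6, whose derivative
  is (ln b - 2 (b - 1)) / 3. On (0,1) it changes sign exactly once, from negative to positive.
*)
theory Submission
  imports Defs
begin

section \<open>Volume as an iterated integral of slice areas\<close>

text \<open>Tonelli, applied twice. The nesting of the product type makes \<open>x\<close> the
  outermost variable, so after \<open>y\<close> is integrated out, \<open>x\<close> and
  \<open>z\<close> are swapped to expose horizontal slices.\<close>

lemma emeasure_lborel_slices:
  fixes S :: "('a::euclidean_space \<times> 'b::euclidean_space \<times> 'c::euclidean_space) set"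
  assumes S: "S \<in> sets borel"
  shows "emeasure lborel S =
    (\<integral>\<^sup>+z. \<integral>\<^sup>+x. emeasure lborel {y. (x, y, z) \<in> S} \<partial>lborel \<partial>lborel)"
proof -
  have S': "S \<in> sets (lborel \<Otimes>\<^sub>M (lborel \<Otimes>\<^sub>M lborel))"
    using S unfolding lborel_prod by simp
  \<comment> \<open>\<open>S\<close> with its coordinates rearranged to \<open>((x, z), y)\<close>:
    the measure of its \<open>y\<close>-sections is then a measurable function of
    \<open>(x, z)\<close>, as the swap requires.\<close>
  have meas: "{w. (fst (fst w), snd w, snd (fst w)) \<in> S}
      \<in> sets ((lborel \<Otimes>\<^sub>M lborel) \<Otimes>\<^sub>M lborel)"
  proof -
    have "(\<lambda>w. (fst (fst w), snd w, snd (fst w))) -` S \<inter> space borel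
        \<in> sets (borel :: (('a \<times> 'c) \<times> 'b) measure)"
      by (rule measurable_sets[OF borel_measurable_continuous_onI S]) (intro continuous_intros)
    then show ?thesis unfolding lborel_prod by (simp add: vimage_def)
  qed
  have f: "(\<lambda>(x, z). emeasure lborel {y. (x, y, z) \<in> S})
      \<in> borel_measurable (lborel \<Otimes>\<^sub>M lborel)"
    using lborel.measurable_emeasure_Pair[OF meas] by (simp add: vimage_def case_prod_beta')
  have "emeasure lborel S = (\<integral>\<^sup>+x. emeasure (lborel \<Otimes>\<^sub>M lborel) (Pair x -` S) \<partial>lborel)"
  proof -
    have "S \<in> sets (lborel \<Otimes>\<^sub>M lborel)" using S unfolding lborel_prod by simp
    from lborel.emeasure_pair_measure_alt[OF this] show ?thesis unfolding lborel_prod .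
  qed
  also have "\<dots> = (\<integral>\<^sup>+x. \<integral>\<^sup>+z. emeasure lborel {y. (x, y, z) \<in> S} \<partial>lborel \<partial>lborel)"
    by (intro nn_integral_cong, subst lborel_pair.emeasure_pair_measure_alt2)
      (use sets_Pair1[OF S'] in \<open>auto simp: vimage_def\<close>)
  also have "\<dots> = (\<integral>\<^sup>+z. \<integral>\<^sup>+x. emeasure lborel {y. (x, y, z) \<in> S} \<partial>lborel \<partial>lborel)"
    by (rule lborel_pair.Fubini'[symmetric, OF f])
  finally show ?thesis .
qed

section \<open>Areas of truncated hyperbolic regions\<close>

text \<open>For \<open>h = r * (1 + b)\<close> this is \<open>K\<close>, the convex hull of the arc
  \<open>x * y = b\<close> in the unit square, scaled by \<open>r\<close> and shifted by
  \<open>(s, s)\<close>. A larger \<open>h\<close> pushes the diagonal edge outwards, which amounts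
  to adding a multiple of the triangle \<open>T\<close>.\<close>

definition hyp_slice :: "real \<Rightarrow> real \<Rightarrow> real \<Rightarrow> real \<Rightarrow> (real \<times> real) set" where
  "hyp_slice b s r h = {(x, y). s + r * b \<le> x \<and> s + r * b \<le> y \<and> x + y \<le> h + 2 * s \<and>
     r\<^sup>2 * b \<le> (x - s) * (y - s)}"

text \<open>The two bounds inside the maximum cross at \<^term>\<open>x = s + r\<close>. For \<^term>\<open>r = 0\<close> the quotient is
  the harmless junk value 0 at \<^term>\<open>x = s\<close>.\<close>
lemma hyp_slice_area_integral:
  fixes b s r h :: real
  assumes b: "0 < b" "b < 1" and r: "0 \<le> r" and h: "r * (1 + b) \<le> h"
  shows "((\<lambda>x. h + s - x - max (r * b) (r\<^sup>2 * b / (x - s))) has_integral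
     (h - 2 * r * b)\<^sup>2 / 2 + r\<^sup>2 * b * ln b + r\<^sup>2 * b * (1 - b)) {s + r * b .. s + h - r * b}"
proof -
  let ?f = "\<lambda>x. h + s - x - max (r * b) (r\<^sup>2 * b / (x - s))"
  let ?F = "\<lambda>x. (h + s) * x - x\<^sup>2 / 2 - r\<^sup>2 * b * ln (x - s)"
  let ?G = "\<lambda>x. (h + s - r * b) * x - x\<^sup>2 / 2"
  have rb: "r * b \<le> r" using b r by (simp add: mult_left_le)
  have rh: "s + r \<le> s + h - r * b" using h by (simp add: algebra_simps)
  have 1: "(?f has_integral ?F (s + r) - ?F (s + r * b)) {s + r * b .. s + r}"
  proof (cases "r = 0")
    case False
    with r have r: "0 < r" by simp
    with b have rb0: "0 < r * b" by simp
    have "((\<lambda>x. h + s - x - r\<^sup>2 * b / (x - s)) has_integral ?F (s + r) - ?F (s + r * b))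
        {s + r * b .. s + r}"
      using rb rb0
      by (intro fundamental_theorem_of_calculus)
        (auto intro!: derivative_eq_intros simp flip: has_real_derivative_iff_has_vector_derivative
          simp: field_simps)
    then show ?thesis
    proof (rule has_integral_eq[rotated])
      fix x assume x: "x \<in> {s + r * b .. s + r}"
      have "r * b * (x - s) \<le> r * b * r" using x rb0 by (intro mult_left_mono) auto
      then have "r * b \<le> r\<^sup>2 * b / (x - s)"
        using x rb0 by (simp add: pos_le_divide_eq power2_eq_square mult_ac)
      then show "h + s - x - r\<^sup>2 * b / (x - s) = ?f x" by simp
    qed
  qed auto
  have 2: "(?f has_integral ?G (s + h - r * b) - ?G (s + r)) {s + r .. s + h - r * b}"
  proof -
    have "((\<lambda>x. h + s - x - r * b) has_integral ?G (s + h - r * b) - ?G (s + r))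
        {s + r .. s + h - r * b}"
      using rh
      by (intro fundamental_theorem_of_calculus)
        (auto intro!: derivative_eq_intros simp flip: has_real_derivative_iff_has_vector_derivative
          simp: field_simps)
    then show ?thesis
    proof (rule has_integral_eq[rotated])
      fix x assume x: "x \<in> {s + r .. s + h - r * b}"
      have "r\<^sup>2 * b / (x - s) \<le> r * b"
      proof (cases "x = s")
        case False
        have "r * b * r \<le> r * b * (x - s)" using x r b by (intro mult_left_mono) auto
        with False x r show ?thesis
          by (simp add: pos_divide_le_eq power2_eq_square mult_ac)
      qed (use r b in simp)
      then show "h + s - x - r * b = ?f x" by simp
    qed
  qed
  have "(?f has_integral (?F (s + r) - ?F (s + r * b)) + (?G (s + h - r * b) - ?G (s + r)))
      {s + r * b .. s + h - r * b}"
    using rb rh by (intro has_integral_combine[OF _ _ 1 2]) auto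
  \<comment> \<open>The \<open>ln r\<close> terms from the two endpoints cancel, leaving only
    \<open>ln b\<close>; for \<open>r = 0\<close> the factor \<open>r\<^sup>2\<close> removes the
    logarithms.\<close>
  moreover have "r\<^sup>2 * b * ln (r * b) = r\<^sup>2 * b * ln r + r\<^sup>2 * b * ln b"
    using b r by (cases "r = 0") (auto simp: ln_mult algebra_simps)
  then have "(?F (s + r) - ?F (s + r * b)) + (?G (s + h - r * b) - ?G (s + r)) =
      (h - 2 * r * b)\<^sup>2 / 2 + r\<^sup>2 * b * ln b + r\<^sup>2 * b * (1 - b)"
    by (simp add: field_simps power2_eq_square)
  ultimately show ?thesis by simp
qed

text \<open>Dividing by \<open>x - s\<close> turns the hyperbolic constraint into a lower bound on
  \<open>y\<close>, so each section is an interval. It is nonempty in the stated range because the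
  diagonal edge lies above both lower bounds.\<close>

lemma hyp_slice_section:
  fixes b s r h x :: real
  assumes b: "0 < b" "b < 1" and r: "0 \<le> r" and h: "r * (1 + b) \<le> h"
  shows "emeasure lborel {y. (x, y) \<in> hyp_slice b s r h} =
      ennreal (h + s - x - max (r * b) (r\<^sup>2 * b / (x - s))) *
        indicator {s + r * b .. s + h - r * b} x"
    and "x \<in> {s + r * b .. s + h - r * b} \<Longrightarrow>
      0 \<le> h + s - x - max (r * b) (r\<^sup>2 * b / (x - s))"
proof -
  let ?m = "max (r * b) (r\<^sup>2 * b / (x - s))"
  have rb0: "0 \<le> r * b" using r b by simp
  have hyp: "r\<^sup>2 * b \<le> (x - s) * v \<longleftrightarrow> r\<^sup>2 * b / (x - s) \<le> v"
    if "s + r * b \<le> x" "r * b \<le> v" for v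
  proof (cases "x = s")
    case True
    \<comment> \<open>At \<open>x = s\<close> both sides of the equivalence become
      \<open>0 \<le> v\<close> or true, since division by zero yields zero.\<close>
    then have "r = 0" using that r b by (auto simp: mult_le_0_iff)
    with True that show ?thesis by simp
  next
    case False
    with that rb0 have "0 < x - s" by simp
    then show ?thesis by (simp add: pos_divide_le_eq mult.commute)
  qed
  show nonneg: "0 \<le> h + s - x - ?m" if x: "x \<in> {s + r * b .. s + h - r * b}"
  proof -
    have "r\<^sup>2 * b \<le> (x - s) * (h + s - x)"
    proof (cases "x \<le> s + r")
      case True
      \<comment> \<open>Between the abscissae \<open>s + r * b\<close> and \<open>s + r\<close> of
        the arc's endpoints, the chord lies above the arc; this product is the difference of the
        two.\<close>
      have "(x - s - r) * (x - s - r * b) \<le> 0"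
        using True x by (intro mult_nonpos_nonneg) auto
      moreover have "(x - s) * (r * (1 + b)) \<le> (x - s) * h"
        using h x rb0 by (intro mult_left_mono) auto
      ultimately show ?thesis by (simp add: algebra_simps power2_eq_square)
    next
      case False
      have "r * (r * b) \<le> (x - s) * (h + s - x)"
        using False x rb0 r by (intro mult_mono) auto
      then show ?thesis by (simp add: power2_eq_square mult_ac)
    qed
    then show ?thesis using hyp[of "h + s - x"] x by auto
  qed
  have "{y. (x, y) \<in> hyp_slice b s r h} =
      (if x \<in> {s + r * b .. s + h - r * b} then {s + ?m .. h + 2 * s - x} else {})"
    using hyp[of "y - s" for y] by (auto simp: hyp_slice_def)
  then show "emeasure lborel {y. (x, y) \<in> hyp_slice b s r h} =
      ennreal (h + s - x - ?m) * indicator {s + r * b .. s + h - r * b} x"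
    using nonneg by (auto simp: algebra_simps)
qed

lemma hyp_slice_area:
  fixes b s r h :: real
  assumes "0 < b" "b < 1" "0 \<le> r" "r * (1 + b) \<le> h"
  defines "A \<equiv> (h - 2 * r * b)\<^sup>2 / 2 + r\<^sup>2 * b * ln b + r\<^sup>2 * b * (1 - b)"
  shows "(\<integral>\<^sup>+x. emeasure lborel {y. (x, y) \<in> hyp_slice b s r h} \<partial>lborel) = ennreal A"
    and "0 \<le> A"
proof -
  note int = hyp_slice_area_integral[OF assms(1-4), of s]
  note sec = hyp_slice_section[OF assms(1-4), of _ s]
  show "(\<integral>\<^sup>+x. emeasure lborel {y. (x, y) \<in> hyp_slice b s r h} \<partial>lborel) = ennreal A"
    unfolding sec(1) A_def by (rule nn_integral_has_integral_lebesgue'[OF sec(2) int])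
  show "0 \<le> A"
    using has_integral_nonneg[OF int sec(2)] by (simp add: A_def)
qed

section \<open>Solids with hyperbolic slices: volume and convexity\<close>

definition hyp_solid :: "real \<Rightarrow> (real \<Rightarrow> real) \<Rightarrow> (real \<Rightarrow> real) \<Rightarrow> (real \<Rightarrow> real) \<Rightarrow> real \<Rightarrow> real
    \<Rightarrow> (real \<times> real \<times> real) set" where
  "hyp_solid b s r h z0 z1 = {(x, y, z). z0 \<le> z \<and> z \<le> z1 \<and> (x, y) \<in> hyp_slice b (s z) (r z) (h z)}"

lemma closed_hyp_solid:
  assumes "continuous_on UNIV s" "continuous_on UNIV r" "continuous_on UNIV h"
  shows "closed (hyp_solid b s r h z0 z1)"
proof -
  note [continuous_intros] = continuous_on_compose2[OF assms(1)]
    continuous_on_compose2[OF assms(2)] continuous_on_compose2[OF assms(3)]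
  show ?thesis
    unfolding hyp_solid_def hyp_slice_def case_prod_beta mem_Collect_eq fst_conv snd_conv
    by (intro closed_Collect_conj closed_Collect_le continuous_intros) auto
qed

text \<open>Cavalieri's principle. The integral of the slice areas enters as a hypothesis, so each
  hull only needs an antiderivative in \<open>z\<close>.\<close>

lemma measure_hyp_solid:
  fixes b z0 z1 :: real and s r h :: "real \<Rightarrow> real"
  assumes "continuous_on UNIV s" "continuous_on UNIV r" "continuous_on UNIV h"
    and b: "0 < b" "b < 1"
    and r: "\<And>z. z0 \<le> z \<Longrightarrow> z \<le> z1 \<Longrightarrow> 0 \<le> r z"
    and h: "\<And>z. z0 \<le> z \<Longrightarrow> z \<le> z1 \<Longrightarrow> r z * (1 + b) \<le> h z"
    and I: "((\<lambda>z. (h z - 2 * r z * b)\<^sup>2 / 2 + (r z)\<^sup>2 * b * ln b + (r z)\<^sup>2 * b * (1 - b))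
      has_integral I) {z0..z1}"
  shows "measure lebesgue (hyp_solid b s r h z0 z1) = I"
proof -
  let ?A = "\<lambda>z. (h z - 2 * r z * b)\<^sup>2 / 2 + (r z)\<^sup>2 * b * ln b + (r z)\<^sup>2 * b * (1 - b)"
  have S: "hyp_solid b s r h z0 z1 \<in> sets borel"
    using closed_hyp_solid[OF assms(1-3)] by simp
  have A0: "0 \<le> ?A z" if "z \<in> {z0..z1}" for z
    using that b r h by (intro hyp_slice_area(2)) auto
  have "emeasure lborel (hyp_solid b s r h z0 z1) = (\<integral>\<^sup>+z. ennreal (?A z) * indicator {z0..z1} z \<partial>lborel)"
    unfolding emeasure_lborel_slices[OF S]
  proof (intro nn_integral_cong)
    fix z
    show "(\<integral>\<^sup>+x. emeasure lborel {y. (x, y, z) \<in> hyp_solid b s r h z0 z1} \<partial>lborel) =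
        ennreal (?A z) * indicator {z0..z1} z"
    proof (cases "z \<in> {z0..z1}")
      case True
      then show ?thesis
        using hyp_slice_area(1)[OF b r[of z] h[of z], of "s z"] by (simp add: hyp_solid_def)
    next
      case False
      then have "{y. (x, y, z) \<in> hyp_solid b s r h z0 z1} = {}" for x
        by (auto simp: hyp_solid_def)
      with False show ?thesis by simp
    qed
  qed
  also have "\<dots> = ennreal I"
    by (rule nn_integral_has_integral_lebesgue'[OF A0 I])
  finally show ?thesis
    using S has_integral_nonneg[OF I A0] by (simp add: measure_def)
qed

text \<open>The triples with \<open>r\<^sup>2 * c \<le> p * q\<close> and nonnegative entries form a
  convex cone. The mixed term is controlled by AM-GM applied to \<open>p * q'\<close> and
  \<open>p' * q\<close>.\<close>

lemma hyperbola_cone_convex: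
  fixes c :: real
  assumes c: "0 \<le> c" and "0 \<le> p" "0 \<le> q" "0 \<le> r" "0 \<le> p'" "0 \<le> q'" "0 \<le> r'"
    and 1: "r\<^sup>2 * c \<le> p * q" and 2: "r'\<^sup>2 * c \<le> p' * q'" and uv: "0 \<le> u" "0 \<le> v"
  shows "(u * r + v * r')\<^sup>2 * c \<le> (u * p + v * p') * (u * q + v * q')"
proof -
  have "(r * r' * c)\<^sup>2 = (r\<^sup>2 * c) * (r'\<^sup>2 * c)" by (simp add: power2_eq_square)
  also have "\<dots> \<le> (p * q) * (p' * q')" by (rule mult_mono[OF 1 2]) (use assms in auto)
  also have "\<dots> \<le> ((p * q' + p' * q) / 2)\<^sup>2"
    using zero_le_power2[of "p * q' - p' * q"] by (simp add: power2_eq_square field_simps)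
  finally have 3: "r * r' * c \<le> (p * q' + p' * q) / 2"
    using assms by (elim power2_le_imp_le) auto
  have "(u * r + v * r')\<^sup>2 * c = u\<^sup>2 * (r\<^sup>2 * c) + v\<^sup>2 * (r'\<^sup>2 * c) + 2 * (u * v) * (r * r' * c)"
    by (simp add: power2_eq_square algebra_simps)
  also have "\<dots> \<le> u\<^sup>2 * (p * q) + v\<^sup>2 * (p' * q') + 2 * (u * v) * ((p * q' + p' * q) / 2)"
    using 1 2 3 uv by (intro add_mono mult_left_mono) auto
  also have "\<dots> = (u * p + v * p') * (u * q + v * q')"
    by (simp add: power2_eq_square algebra_simps)
  finally show ?thesis .
qed

text \<open>The last three hypotheses say that \<open>s\<close>, \<open>r\<close>, \<open>h\<close>
  are affine. The linear constraints are then convex in \<open>(x, y, z)\<close>, and the hyperbolic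
  one pulls back the cone above along \<open>(x - s z, y - s z, r z)\<close>.\<close>

lemma convex_hyp_solid:
  fixes b :: real
  assumes b: "0 \<le> b"
    and r0: "\<And>z. z0 \<le> z \<Longrightarrow> z \<le> z1 \<Longrightarrow> 0 \<le> r z"
    and s: "\<And>u v z w. u + v = 1 \<Longrightarrow> s (u * z + v * w) = u * s z + v * s w"
    and r: "\<And>u v z w. u + v = 1 \<Longrightarrow> r (u * z + v * w) = u * r z + v * r w"
    and h: "\<And>u v z w. u + v = 1 \<Longrightarrow> h (u * z + v * w) = u * h z + v * h w"
  shows "convex (hyp_solid b s r h z0 z1)"
proof (rule convexI, clarify)
  fix x y z x' y' z' and u v :: real
  assume P: "(x, y, z) \<in> hyp_solid b s r h z0 z1" and P': "(x', y', z') \<in> hyp_solid b s r h z0 z1"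
    and uv: "0 \<le> u" "0 \<le> v" "u + v = 1"
  let ?z = "u * z + v * z'"
  have rz: "0 \<le> r z" "0 \<le> r z'" using P P' r0 by (auto simp: hyp_solid_def)
  have mono: "u * a + v * a' \<le> u * c + v * c'" if "a \<le> c" "a' \<le> c'" for a a' c c'
    using that uv by (intro add_mono mult_left_mono)
  have pos: "t \<le> a" if "t + q * b \<le> a" "0 \<le> q" for a t q :: real
    using that b by (smt (verit) mult_nonneg_nonneg)
  have "u * z0 + v * z0 \<le> ?z" "?z \<le> u * z1 + v * z1"
    using P P' by (auto simp: hyp_solid_def intro!: mono)
  moreover have "u * z0 + v * z0 = z0" "u * z1 + v * z1 = z1"
    using uv(3) by (simp_all flip: distrib_right)
  moreover have "u * (s z + r z * b) + v * (s z' + r z' * b) \<le> u * x + v * x'"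
    "u * (s z + r z * b) + v * (s z' + r z' * b) \<le> u * y + v * y'"
    "u * (x + y) + v * (x' + y') \<le> u * (h z + 2 * s z) + v * (h z' + 2 * s z')"
    using P P' by (auto simp: hyp_solid_def hyp_slice_def simp del: distrib_left intro!: mono)
  moreover have "s z \<le> x" "s z \<le> y" "s z' \<le> x'" "s z' \<le> y'"
    using P P' rz by (auto simp: hyp_solid_def hyp_slice_def intro: pos)
  then have "(u * r z + v * r z')\<^sup>2 * b
      \<le> (u * (x - s z) + v * (x' - s z')) * (u * (y - s z) + v * (y' - s z'))"
    using P P' uv rz b
    by (intro hyperbola_cone_convex) (auto simp: hyp_solid_def hyp_slice_def)
  ultimately show "u *\<^sub>R (x, y, z) + v *\<^sub>R (x', y', z') \<in> hyp_solid b s r h z0 z1"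
    by (simp add: hyp_solid_def hyp_slice_def s[OF uv(3)] r[OF uv(3)] h[OF uv(3)] algebra_simps)
qed

section \<open>Identification of the two convex hulls\<close>

lemma convex_real3D:
  fixes C :: "(real \<times> real \<times> real) set"
  assumes "convex C" "(a, c, d) \<in> C" "(a', c', d') \<in> C" "0 \<le> t" "t \<le> 1"
    and "x = (1 - t) * a + t * a'" "y = (1 - t) * c + t * c'" "z = (1 - t) * d + t * d'"
  shows "(x, y, z) \<in> C"
  using convexD_alt[OF assms(1-5)] assms(6-) by simp

text \<open>Reduces membership of a point to that of two boundary points on its line parallel to the
  \<open>x\<close>-axis.\<close>

lemma convex_horizontal:
  fixes C :: "(real \<times> real \<times> real) set"
  assumes C: "convex C" and "(a, y, z) \<in> C" "(a', y, z) \<in> C" "a \<le> x" "x \<le> a'"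
  shows "(x, y, z) \<in> C"
proof (cases "a = a'")
  case False
  define t where "t = (x - a) / (a' - a)"
  have "x = a + t * (a' - a)" "0 \<le> t" "t \<le> 1" using assms False by (auto simp: t_def)
  then show ?thesis
    by (intro convex_real3D[OF C assms(2,3), of t]) (auto simp: algebra_simps)
qed (use assms in auto)

text \<open>The solid is convex and contains \<open>F_ge b\<close>. Conversely it is the cone with
  apex \<open>(1, 1, 1)\<close> over its slice at \<open>z = b\<close>, and that slice is filled by
  segments from the arc to its chord.\<close>

lemma hull_F_ge:
  assumes b: "0 < b" "b < 1"
  shows "convex hull F_ge b =
    hyp_solid b (\<lambda>z. (z - b) / (1 - b)) (\<lambda>z. (1 - z) / (1 - b)) (\<lambda>z. (1 - z) / (1 - b) * (1 + b)) b 1"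
    (is "?C = ?H")
proof
  show "?C \<subseteq> ?H"
  proof (rule hull_minimal)
    show "convex ?H"
    proof (rule convex_hyp_solid)
      fix u v z w :: real
      assume "u + v = 1"
      then have v: "v = 1 - u" by simp
      have "u * z + v * w - b = u * (z - b) + v * (w - b)" by (simp add: v algebra_simps)
      then show "(u * z + v * w - b) / (1 - b) = u * ((z - b) / (1 - b)) + v * ((w - b) / (1 - b))"
        by (simp add: add_divide_distrib)
      have "1 - (u * z + v * w) = u * (1 - z) + v * (1 - w)" by (simp add: v algebra_simps)
      then show r: "(1 - (u * z + v * w)) / (1 - b) = u * ((1 - z) / (1 - b)) + v * ((1 - w) / (1 - b))"
        by (simp add: add_divide_distrib)
      show "(1 - (u * z + v * w)) / (1 - b) * (1 + b) =
          u * ((1 - z) / (1 - b) * (1 + b)) + v * ((1 - w) / (1 - b) * (1 + b))"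
        unfolding r by (simp add: distrib_right)
    qed (use b in auto)
    show "F_ge b \<subseteq> ?H"
    proof clarify
      fix x y z assume "(x, y, z) \<in> F_ge b"
      then have z: "z = x * y" and x: "0 \<le> x" "x \<le> 1" and y: "0 \<le> y" "y \<le> 1" and xy: "b \<le> x * y" "x * y \<le> 1"
        by (auto simp: F_ge_def)
      \<comment> \<open>The weight of the apex at height \<open>x * y\<close>, where the base has
        height \<open>b\<close> and the apex height 1.\<close>
      define s where "s = (x * y - b) / (1 - b)"
      have xys: "x * y = b + s * (1 - b)" using b by (simp add: s_def)
      have r: "(1 - x * y) / (1 - b) = 1 - s" using b by (simp add: s_def field_simps)
      have "x * y \<le> x" "x * y \<le> y" using x y by (simp_all add: mult_left_le mult_left_le_one_le)
      moreover have sxy: "s + (1 - s) * b = x * y" using xys by (simp add: algebra_simps)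
      moreover have McCormick: "x + y \<le> 1 + x * y"
        using mult_nonneg_nonneg[of "1 - x" "1 - y"] x y by (simp add: algebra_simps)
      moreover have top: "(1 - s) * (1 + b) + 2 * s = 1 + x * y"
        using xys by (simp add: algebra_simps)
      moreover have "(1 - s)\<^sup>2 * b \<le> (x - s) * (y - s)"
      proof -
        \<comment> \<open>Once both sides are expanded, the hyperbolic constraint is
          \<open>s\<close> times the McCormick inequality.\<close>
        have "0 \<le> s" using b xy by (simp add: s_def)
        then have "s * (x + y) \<le> s * (1 + x * y)" using McCormick by (intro mult_left_mono)
        moreover have "(1 - s)\<^sup>2 * b = x * y - s * (1 + x * y) + s\<^sup>2"
          unfolding xys by (simp add: power2_eq_square algebra_simps)
        moreover have "(x - s) * (y - s) = x * y - s * (x + y) + s\<^sup>2"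
          by (simp add: power2_eq_square algebra_simps)
        ultimately show ?thesis by linarith
      qed
      ultimately show "(x, y, z) \<in> ?H"
        using xy unfolding z hyp_solid_def hyp_slice_def mem_Collect_eq case_prod_conv r s_def[symmetric]
        by (simp only: sxy top simp_thms)
    qed
  qed
  have F: "p \<in> ?C" if "p \<in> F_ge b" for p using that by (rule hull_inc)
  have C: "convex ?C" by simp
  \<comment> \<open>At ordinate \<open>q\<close> the base slice runs from the arc point
    \<open>b / q\<close> to the point \<open>1 + b - q\<close> on the chord from
    \<open>(1, b)\<close> to \<open>(b, 1)\<close>.\<close>
  have base: "(p, q, b) \<in> ?C" if pq: "b \<le> p" "b \<le> q" "p + q \<le> 1 + b" "b \<le> p * q" for p q
  proof (rule convex_horizontal[OF C])
    show "(b / q, q, b) \<in> ?C" using b pq by (intro F) (auto simp: F_ge_def field_simps)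
    show "b / q \<le> p" using b pq by (simp add: field_simps)
    have "(1, b, b) \<in> ?C" "(b, 1, b) \<in> ?C" by (rule F, use b in \<open>simp add: F_ge_def\<close>)+
    then show "(1 + b - q, q, b) \<in> ?C"
      by (rule convex_real3D[OF C, where t = "(q - b) / (1 - b)"])
        (use b pq in \<open>auto simp: divide_simps\<close>, auto simp: algebra_simps)
  qed (use pq in simp)
  show "?H \<subseteq> ?C"
  proof clarify
    fix x y z assume H: "(x, y, z) \<in> ?H"
    define s where "s = (z - b) / (1 - b)"
    have "s * (1 - b) = z - b" using b by (simp add: s_def)
    then have z: "z = (1 - s) * b + s * 1" by (simp add: algebra_simps)
    then have "1 - z = (1 - s) * (1 - b)" by (simp add: algebra_simps)
    then have r: "(1 - z) / (1 - b) = 1 - s" using b by simp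
    have s01: "0 \<le> s" "s \<le> 1" using H b by (auto simp: s_def hyp_solid_def)
    have H': "s + (1 - s) * b \<le> x" "s + (1 - s) * b \<le> y" "x + y \<le> (1 - s) * (1 + b) + 2 * s"
      "(1 - s)\<^sup>2 * b \<le> (x - s) * (y - s)"
      using H unfolding hyp_solid_def hyp_slice_def mem_Collect_eq case_prod_conv r s_def[symmetric]
      by blast+
    have apex: "(1, 1, 1) \<in> ?C" by (rule F) (use b in \<open>auto simp: F_ge_def\<close>)
    show "(x, y, z) \<in> ?C"
    proof (cases "s = 1")
      case True
      with H' have "x = 1" "y = 1" by simp_all
      with True z apex show ?thesis by simp
    next
      case False
      with s01 have s1: "0 < 1 - s" by simp
      \<comment> \<open>Central projection of \<open>(x, y, z)\<close> from the apex onto the plane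
        \<open>z = b\<close>.\<close>
      have "((x - s) / (1 - s), (y - s) / (1 - s), b) \<in> ?C"
      proof (rule base)
        show "b \<le> (x - s) / (1 - s)" "b \<le> (y - s) / (1 - s)"
          using H' s1 by (simp_all add: pos_le_divide_eq mult.commute)
        have "(x - s) / (1 - s) + (y - s) / (1 - s) = (x + y - 2 * s) / (1 - s)"
          by (simp flip: add_divide_distrib)
        then show "(x - s) / (1 - s) + (y - s) / (1 - s) \<le> 1 + b"
          using H' s1 by (simp add: pos_divide_le_eq mult.commute)
        have "(x - s) / (1 - s) * ((y - s) / (1 - s)) = (x - s) * (y - s) / (1 - s)\<^sup>2"
          by (simp add: power2_eq_square)
        moreover have "b \<le> (x - s) * (y - s) / (1 - s)\<^sup>2"
          using H' s1 by (simp add: pos_le_divide_eq mult.commute)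
        ultimately show "b \<le> (x - s) / (1 - s) * ((y - s) / (1 - s))" by argo
      qed
      then show ?thesis
        by (rule convex_real3D[OF C _ apex s01]) (use s1 z in auto)
    qed
  qed
qed

text \<open>The linear bounds \<open>z \<le> x\<close>, \<open>z \<le> y\<close>,
  \<open>x + y \<le> 1 + z\<close> are McCormick inequalities, and the hyperbolic bound is the cone
  from the origin over the arc at height \<open>b\<close>; on the surface it follows from
  \<open>x * y \<le> b\<close>. Conversely, every point lies on a horizontal segment between two
  boundary points built from points of \<open>F_le b\<close>.\<close>

lemma hull_F_le:
  assumes b: "0 < b" "b < 1"
  shows "convex hull F_le b = hyp_solid b (\<lambda>z. 0) (\<lambda>z. z / b) (\<lambda>z. 1 + z) 0 b" (is "?C = ?H")
proof
  show "?C \<subseteq> ?H"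
  proof (rule hull_minimal)
    show "convex ?H"
    proof (rule convex_hyp_solid)
      fix u v z w :: real
      assume "u + v = 1"
      then have v: "v = 1 - u" by simp
      show "1 + (u * z + v * w) = u * (1 + z) + v * (1 + w)"
        by (simp add: v algebra_simps)
    qed (use b in \<open>auto simp: field_simps\<close>)
    show "F_le b \<subseteq> ?H"
    proof clarify
      fix x y z assume "(x, y, z) \<in> F_le b"
      then have z: "z = x * y" and x: "0 \<le> x" "x \<le> 1" and y: "0 \<le> y" "y \<le> 1" and xy: "0 \<le> x * y" "x * y \<le> b"
        by (auto simp: F_le_def)
      have "x * y \<le> x" "x * y \<le> y" using x y by (simp_all add: mult_left_le mult_left_le_one_le)
      moreover have "x + y \<le> 1 + x * y"
        using mult_nonneg_nonneg[of "1 - x" "1 - y"] x y by (simp add: algebra_simps)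
      moreover have "(x * y / b)\<^sup>2 * b \<le> x * y"
      proof -
        have "x * y * (x * y) \<le> x * y * b" using xy by (intro mult_left_mono)
        then show ?thesis using b by (simp add: power2_eq_square field_simps)
      qed
      ultimately show "(x, y, z) \<in> ?H"
        using b xy by (simp add: z hyp_solid_def hyp_slice_def)
    qed
  qed
  have F: "p \<in> ?C" if "p \<in> F_le b" for p using that by (rule hull_inc)
  have C: "convex ?C" by simp
  show "?H \<subseteq> ?C"
  proof clarify
    fix x y z assume H: "(x, y, z) \<in> ?H"
    define t where "t = z / b"
    have z: "z = t * b" using b by (simp add: t_def)
    have t: "0 \<le> t" "t \<le> 1" using H b by (auto simp: t_def hyp_solid_def)
    have H': "t * b \<le> x" "t * b \<le> y" "x + y \<le> 1 + t * b" "t\<^sup>2 * b \<le> x * y"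
      using H unfolding hyp_solid_def hyp_slice_def mem_Collect_eq case_prod_conv t_def[symmetric]
      by (simp_all add: z)
    have y1: "y \<le> 1" using H' by simp
    have tb: "0 \<le> t * b" "t * b < 1" using t b
      by (simp, meson mult_le_one le_less_trans mult_left_le_one_le less_imp_le)
    \<comment> \<open>In direction \<open>x\<close>, a slice is bounded on the right by the facet \<open>x + y = 1 + z\<close> and on the left
      by a segment from the origin to the arc (\<open>y \<le> t\<close>) or by the facet \<open>x = z\<close> (\<open>t < y\<close>).\<close>
    have facet: "(1 + z - y, y, z) \<in> ?C"
    proof -
      \<comment> \<open>The facet is a trapezoid with parallel edges at heights 0 and
        \<open>b\<close>. Points dividing both edges in the same ratio \<open>w\<close> are joined
        with weight \<open>t\<close>; \<open>w\<close> is solved from the resulting ordinate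
        \<open>y\<close>.\<close>
      define w where "w = (y - t * b) / (1 - t * b)"
      have w: "0 \<le> w" "w \<le> 1" using H' y1 tb by (auto simp: w_def)
      have y: "y = t * b + w * (1 - t * b)" using tb by (simp add: w_def)
      have "(1, 0, 0) \<in> ?C" "(0, 1, 0) \<in> ?C" by (rule F, use b in \<open>simp add: F_le_def\<close>)+
      then have 1: "(1 - w, w, 0) \<in> ?C"
        by (rule convex_real3D[OF C _ _ w]) auto
      have "(1, b, b) \<in> ?C" "(b, 1, b) \<in> ?C" by (rule F, use b in \<open>simp add: F_le_def\<close>)+
      then have 2: "((1 - w) + w * b, (1 - w) * b + w, b) \<in> ?C"
        by (rule convex_real3D[OF C _ _ w]) (auto simp: algebra_simps)
      show ?thesis
        by (rule convex_real3D[OF C 1 2 t]) (auto simp: y z algebra_simps)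
    qed
    show "(x, y, z) \<in> ?C"
    proof (cases "y \<le> t")
      case True
      show ?thesis
      proof (cases "t = 0")
        case True
        with \<open>y \<le> t\<close> H' have yz: "y = 0" "z = 0" by (auto simp: z)
        have "(0, 0, 0) \<in> ?C" by (rule F, use b in \<open>simp add: F_le_def\<close>)+
        with yz have "(0, y, z) \<in> ?C" by simp
        then show ?thesis
          by (rule convex_horizontal[OF C _ facet]) (use H' True z in auto)
      next
        case False
        with t have t0: "0 < t" by simp
        with b have "0 < t * b" by simp
        with H' have y0: "0 < y" by simp
        have 0: "(0, 0, 0) \<in> ?C" by (rule F, use b in \<open>simp add: F_le_def\<close>)+
        \<comment> \<open>The arc point whose multiple by \<open>t\<close> has ordinate
          \<open>y\<close>; \<open>y \<le> t\<close> keeps it inside the unit square.\<close>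
        have 1: "(t * b / y, y / t, b) \<in> ?C"
          using b t0 y0 H' True by (intro F) (auto simp: F_le_def field_simps)
        have "(t\<^sup>2 * b / y, y, z) \<in> ?C"
          by (rule convex_real3D[OF C 0 1 t]) (use t0 z in \<open>auto simp: power2_eq_square\<close>)
        then show ?thesis
          by (rule convex_horizontal[OF C _ facet]) (use H' y0 z in \<open>auto simp: pos_divide_le_eq\<close>)
      qed
    next
      case False
      with y1 have t1: "0 < 1 - t" by simp
      \<comment> \<open>A point of the edge \<open>x = z = 0\<close>, chosen so that joining it to
        the arc's endpoint \<open>(b, 1, b)\<close> with weight \<open>t\<close> gives ordinate
        \<open>y\<close>.\<close>
      have 1: "(0, (y - t) / (1 - t), 0) \<in> ?C"
        using b t1 False y1 by (intro F) (auto simp: F_le_def)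
      have 2: "(b, 1, b) \<in> ?C" by (rule F, use b in \<open>simp add: F_le_def\<close>)+
      have "(t * b, y, z) \<in> ?C"
        by (rule convex_real3D[OF C 1 2 t]) (use t1 z in auto)
      then show ?thesis
        by (rule convex_horizontal[OF C _ facet]) (use H' z in auto)
    qed
  qed
qed

section \<open>Volumes of the hulls\<close>

text \<open>Cone formula: height \<open>1 - b\<close> times base area over 3. The base area is
  \<open>?A\<close>, and slices shrink by the square of \<open>?r\<close>.\<close>

lemma measure_hull_F_ge:
  assumes b: "0 < b" "b < 1"
  shows "measure lebesgue (convex hull F_ge b) = (1 - b) * ((1 - b\<^sup>2) / 2 + b * ln b) / 3"
proof -
  let ?r = "\<lambda>z. (1 - z) / (1 - b)"
  let ?A = "(1 - b\<^sup>2) / 2 + b * ln b"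
  let ?F = "\<lambda>z. - ((1 - z) ^ 3) / 3 * (?A / (1 - b)\<^sup>2)"
  \<comment> \<open>An arbitrary constant \<open>K\<close> keeps the logarithm in \<open>?A\<close>
    out of the differentiation.\<close>
  have "((\<lambda>z. (1 - z)\<^sup>2 * K) has_integral (- ((1 - 1) ^ 3) / 3 * K - - ((1 - b) ^ 3) / 3 * K)) {b..1}" for K
    using b by (intro fundamental_theorem_of_calculus)
      (auto intro!: derivative_eq_intros simp flip: has_real_derivative_iff_has_vector_derivative)
  then have "((\<lambda>z. (1 - z)\<^sup>2 * (?A / (1 - b)\<^sup>2)) has_integral (?F 1 - ?F b)) {b..1}" .
  also have "(\<lambda>z. (1 - z)\<^sup>2 * (?A / (1 - b)\<^sup>2)) = (\<lambda>z. (?r z * (1 + b) - 2 * ?r z * b)\<^sup>2 / 2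
      + (?r z)\<^sup>2 * b * ln b + (?r z)\<^sup>2 * b * (1 - b))"
  proof
    fix z
    have "(r * (1 + b) - 2 * r * b)\<^sup>2 / 2 + r\<^sup>2 * b * ln b + r\<^sup>2 * b * (1 - b) = r\<^sup>2 * ?A" for r
      by (simp add: power2_eq_square field_simps)
    from this[of "?r z"] show "(1 - z)\<^sup>2 * (?A / (1 - b)\<^sup>2) = (?r z * (1 + b) - 2 * ?r z * b)\<^sup>2 / 2
        + (?r z)\<^sup>2 * b * ln b + (?r z)\<^sup>2 * b * (1 - b)"
      by (simp add: power_divide)
  qed
  also have "?F 1 - ?F b = (1 - b) * ?A / 3"
  proof -
    have "d ^ 3 / 3 * (K / d\<^sup>2) = d * K / 3" if "d \<noteq> 0" for d K :: real
      using that by (simp add: power2_eq_square power3_eq_cube)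
    from this[of "1 - b" ?A] show ?thesis using b by simp
  qed
  finally show ?thesis
    unfolding hull_F_ge[OF b]
    by (intro measure_hyp_solid) (use b in \<open>auto intro!: continuous_intros\<close>)
qed

text \<open>Here \<open>h - 2 * r * b\<close> is \<open>1 - z\<close>, so the slice area is
  quadratic in \<open>z\<close>. The two summands of the result are the volumes of the cones from
  the origin over the facet \<open>x + y = 1 + z\<close> and over the top slice.\<close>

lemma measure_hull_F_le:
  assumes b: "0 < b" "b < 1"
  shows "measure lebesgue (convex hull F_le b) = b * (2 - b) / 6 + b * ((1 - b\<^sup>2) / 2 + b * ln b) / 3"
proof -
  let ?F = "\<lambda>z. - ((1 - z) ^ 3) / 6 + z ^ 3 / (3 * b) * (ln b + (1 - b))"
  have "((\<lambda>z. (1 - z)\<^sup>2 / 2 + z\<^sup>2 / b * (ln b + (1 - b))) has_integral (?F b - ?F 0)) {0..b}"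
    using b by (intro fundamental_theorem_of_calculus)
      (auto intro!: derivative_eq_intros simp flip: has_real_derivative_iff_has_vector_derivative)
  also have "(\<lambda>z. (1 - z)\<^sup>2 / 2 + z\<^sup>2 / b * (ln b + (1 - b))) = (\<lambda>z. (1 + z - 2 * (z / b) * b)\<^sup>2 / 2
      + (z / b)\<^sup>2 * b * ln b + (z / b)\<^sup>2 * b * (1 - b))"
    using b by (intro ext) (simp add: power2_eq_square field_simps)
  also have "?F b - ?F 0 = b * (2 - b) / 6 + b * ((1 - b\<^sup>2) / 2 + b * ln b) / 3"
    using b by (simp add: power2_eq_square power3_eq_cube field_simps)
  finally show ?thesis
    unfolding hull_F_le[OF b]
    by (intro measure_hyp_solid) (use b in \<open>auto intro!: continuous_intros simp: field_simps\<close>)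
qed

lemma hull_volume_sum_eq:
  assumes "0 < b" "b < 1"
  shows "hull_volume_sum b = (1 + 2 * b - 2 * b\<^sup>2 + 2 * b * ln b) / 6"
  using assms
  by (simp add: hull_volume_sum_def measure_hull_F_ge measure_hull_F_le power2_eq_square field_simps)

section \<open>Critical point and minimization\<close>

text \<open>The function \<open>ln x - 2 * (x - 1)\<close> increases up to \<open>1 / 2\<close> and
  decreases afterwards. It vanishes at 1, so it is positive on \<open>[1/2, 1)\<close> and its only
  other zero lies to the left of \<open>1 / 2\<close>.\<close>

lemma critical_point:
  obtains c :: real where "0.15 < c" "c < 0.25" "ln c = 2 * (c - 1)"
    "\<And>x. 0 < x \<Longrightarrow> x < c \<Longrightarrow> ln x - 2 * (x - 1) < 0"
    "\<And>x. c < x \<Longrightarrow> x < 1 \<Longrightarrow> 0 < ln x - 2 * (x - 1)"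
proof -
  let ?d = "\<lambda>x::real. ln x - 2 * (x - 1)"
  have cont: "continuous_on {a..e} ?d" if "0 < a" for a e
    using that by (intro continuous_intros) auto
  have d': "DERIV ?d x :> 1 / x - 2" if "0 < x" for x
    using that by (auto intro!: derivative_eq_intros)
  have inc: "?d x < ?d y" if "0 < x" "x < y" "y \<le> 1 / 2" for x y
  proof (rule DERIV_pos_imp_increasing_open[OF that(2) _ cont[OF that(1)]])
    fix t assume "x < t" "t < y"
    with that show "\<exists>D. DERIV ?d t :> D \<and> 0 < D"
      by (intro exI[of _ "1 / t - 2"] conjI d') (auto simp: field_simps)
  qed
  have dec: "?d y < ?d x" if "1 / 2 \<le> x" "x < y" for x y
  proof (rule DERIV_neg_imp_decreasing_open[OF that(2) _ cont])
    fix t assume "x < t" "t < y"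
    with that show "\<exists>D. DERIV ?d t :> D \<and> D < 0"
      by (intro exI[of _ "1 / t - 2"] conjI d') (auto simp: field_simps)
  qed (use that in simp)
  have low: "?d 0.15 < 0"
  proof -
    \<comment> \<open>The claim is \<open>1.7 < ln (20 / 3)\<close>; exponentiating ten times both
      sides leaves an inequality between powers of rationals once \<open>exp 1\<close> is bounded by
      2.72.\<close>
    have "exp (17::real) = exp 1 ^ 17" by (simp flip: exp_of_nat_mult)
    also have "\<dots> \<le> (2.72::real) ^ 17" using e_less_272 by (intro power_mono) auto
    also have "\<dots> < (20 / 3) ^ 10" by (simp add: power_divide)
    finally have "ln (exp 17) < ln ((20 / 3 :: real) ^ 10)" by (subst ln_less_cancel_iff) auto
    then have "1.7 < ln (20 / 3 :: real)" by (simp add: ln_realpow)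
    then show ?thesis using ln_inverse[of "20 / 3 :: real"] by simp
  qed
  have high: "0 < ?d 0.25"
  proof -
    \<comment> \<open>Since \<open>ln 0.25 = - 2 * ln 2\<close>, positivity amounts to
      \<open>ln 2 < 0.75\<close>.\<close>
    have "2 < exp (0.75 :: real)"
      using exp_lower_Taylor_quadratic[of "0.75 :: real"] by (simp add: power2_eq_square)
    then have "ln (2 :: real) < ln (exp 0.75)" by (subst ln_less_cancel_iff) auto
    moreover have "ln (0.25 :: real) = - 2 * ln 2"
      using ln_inverse[of "2 ^ 2 :: real"] ln_realpow[of "2 :: real" 2] by simp
    ultimately show ?thesis by simp
  qed
  obtain c where c: "0.15 \<le> c" "c \<le> 0.25" "?d c = 0"
    using IVT'[of ?d "0.15" 0 "0.25"] low high cont[of "0.15" "0.25"] by auto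
  show thesis
  proof (rule that)
    have "c \<noteq> 0.15" "c \<noteq> 0.25" using c(3) low high by (metis less_irrefl)+
    with c show "0.15 < c" "c < 0.25" by auto
    show "ln c = 2 * (c - 1)" using c by simp
    show "?d x < 0" if "0 < x" "x < c" for x using inc[of x c] that c by auto
    show "0 < ?d x" if "c < x" "x < 1" for x
      using inc[of c x] dec[of x 1] that c by (cases "x \<le> 1 / 2") auto
  qed
qed

theorem mainTheorem12:
  "(\<exists>!b. is_arg_min hull_volume_sum (\<lambda>b. 0 < b \<and> b < 1) b) \<and>
   (\<forall>b. is_arg_min hull_volume_sum (\<lambda>b. 0 < b \<and> b < 1) b \<longrightarrow>
      ln b = 2 * (b - 1) \<and> \<bar>b - 0.2\<bar> < 0.05)"
proof -
  obtain c :: real where c: "0.15 < c" "c < 0.25" "ln c = 2 * (c - 1)"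
    and neg: "\<And>x. 0 < x \<Longrightarrow> x < c \<Longrightarrow> ln x - 2 * (x - 1) < 0"
    and pos: "\<And>x. c < x \<Longrightarrow> x < 1 \<Longrightarrow> 0 < ln x - 2 * (x - 1)"
    by (rule critical_point) blast
  let ?V = "\<lambda>b::real. (1 + 2 * b - 2 * b\<^sup>2 + 2 * b * ln b) / 6"
  have V': "DERIV ?V x :> (ln x - 2 * (x - 1)) / 3" if "0 < x" for x
    using that by (auto intro!: derivative_eq_intros simp: field_simps)
  have cont: "continuous_on {a..e} ?V" if "0 < a" for a e
    using that by (intro continuous_intros) auto
  \<comment> \<open>The strict inequality on both sides of \<open>c\<close> gives minimality and
    uniqueness at once.\<close>
  have min: "?V c < ?V x" if x: "0 < x" "x < 1" "x \<noteq> c" for x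
  proof (cases "x < c")
    case True
    show ?thesis
    proof (rule DERIV_neg_imp_decreasing_open[OF True _ cont[OF x(1)]])
      fix t assume "x < t" "t < c"
      with x show "\<exists>D. DERIV ?V t :> D \<and> D < 0"
        using neg[of t] by (intro exI[of _ "(ln t - 2 * (t - 1)) / 3"] conjI V') auto
    qed
  next
    case False
    with x have "c < x" by simp
    then show ?thesis
    proof (rule DERIV_pos_imp_increasing_open[OF _ _ cont])
      fix t assume "c < t" "t < x"
      with x c show "\<exists>D. DERIV ?V t :> D \<and> 0 < D"
        using pos[of t] by (intro exI[of _ "(ln t - 2 * (t - 1)) / 3"] conjI V') auto
    qed (use c in simp)
  qed
  have "is_arg_min hull_volume_sum (\<lambda>b. 0 < b \<and> b < 1) b \<longleftrightarrow> b = c" for b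
  proof
    assume b: "is_arg_min hull_volume_sum (\<lambda>b. 0 < b \<and> b < 1) b"
    show "b = c"
    proof (rule ccontr)
      assume "b \<noteq> c"
      with b min[of b] have "hull_volume_sum c < hull_volume_sum b"
        using c by (auto simp: is_arg_min_def hull_volume_sum_eq)
      with b c show False by (auto simp: is_arg_min_def)
    qed
  next
    assume "b = c"
    then show "is_arg_min hull_volume_sum (\<lambda>b. 0 < b \<and> b < 1) b"
      using c min by (force simp: is_arg_min_def hull_volume_sum_eq)
  qed
  moreover have "\<bar>c - 0.2\<bar> < 0.05" unfolding abs_less_iff using c(1,2) by simp
  ultimately show ?thesis using c(3) by simp
qed

end
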